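(* Let $T$ be the infinite rooted binary tree (every vertex has exactly two children), and for $n\ge 0$ let $L_n$ be the $n$-th level of $T$, i.e. the set of the $2^n$ vertices at distance $n$ from the root. On the vertices of each level place a $3$-regular expander: that is, for every $n\ge 0$ let $E_n$ be a $3$-regular graph with vertex set $L_n$, such that the graphs $(E_n)_{n\ge 0}$ are uniform expanders, meaning that there is a constant $c>0$, not depending on $n$, such that for every $n$ and every nonempty $S\subseteq L_n$ with $|S|\le\tfrac12|L_n|$, the number of vertices of $L_n\setminus S$ having an $E_n$-neighbour in $S$ is greater than $c|S|$. Let $G$ be the graph obtained from $T$ by adding, for every $n\ge 0$, all the edges of $E_n$. Then $G$ (which has bounded degree) is nonamenable and Liouville.
   Context: Graphs are undirected; loops and multiple edges are allowed, a loop contributing one to the degree of its vertex. For a finite set $S$ of vertices of a graph, $\partial S$ denotes the set of vertices not in $S$ that have a neighbour in $S$. An infinite graph is nonamenable if there is a constant $C>0$ such that $\inf_S |\partial S|/|S|>C$, the infimum being over all finite nonempty sets $S$ of vertices. A function $h:V(G)\to\mathbb{R}$ is harmonic if for every vertex $v$ the value $h(v)$ is the average of $h$ over the $\deg(v)$ edges at $v$, evaluated at their other endpoints (with multiplicity; a loop at $v$ contributes $h(v)$), i.e. $h$ is harmonic for simple random walk on $G$. A graph is Liouville if it admits no non-constant bounded harmonic functions. *)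

theory Defs
  imports "HOL-Analysis.Analysis"
begin

text \<open>
  An undirected multigraph is given by its vertices and, for each pair of vertices, the number of
  edges joining them.  For a loop, \<open>mult G v v\<close> counts every loop at \<open>v\<close> once, so that each loop
  contributes one to the degree.
\<close>

record 'v multigraph =
  verts :: "'v set"
  mult :: "'v \<Rightarrow> 'v \<Rightarrow> nat"

definition nbrs :: "'v multigraph \<Rightarrow> 'v \<Rightarrow> 'v set" where
  "nbrs G v = {w. mult G v w > 0}"

text \<open>Local finiteness makes degrees and vertex boundaries of finite sets finite; it is automatic
  when \<open>verts G\<close> is finite.\<close>

locale multigraph =
  fixes G :: "'v multigraph"
  assumes mult_sym: "mult G u v = mult G v u"
    and mult_verts: "mult G u v > 0 \<Longrightarrow> u \<in> verts G \<and> v \<in> verts G"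
    and locally_finite: "finite (nbrs G v)"

definition vertex_degree :: "'v multigraph \<Rightarrow> 'v \<Rightarrow> nat" where
  "vertex_degree G v = (\<Sum>w\<in>nbrs G v. mult G v w)"

definition regular :: "nat \<Rightarrow> 'v multigraph \<Rightarrow> bool" where
  "regular d G \<longleftrightarrow> (\<forall>v\<in>verts G. vertex_degree G v = d)"

definition bounded_degree :: "'v multigraph \<Rightarrow> bool" where
  "bounded_degree G \<longleftrightarrow> (\<exists>D. \<forall>v\<in>verts G. vertex_degree G v \<le> D)"

definition vertex_boundary :: "'v multigraph \<Rightarrow> 'v set \<Rightarrow> 'v set" where
  "vertex_boundary G S = {v \<in> verts G. v \<notin> S \<and> (\<exists>u\<in>S. u \<in> nbrs G v)}"

definition nonamenable :: "'v multigraph \<Rightarrow> bool" where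
  "nonamenable G \<longleftrightarrow> infinite (verts G) \<and>
     (\<exists>C>0. (INF S\<in>{S. S \<subseteq> verts G \<and> finite S \<and> S \<noteq> {}}.
               real (card (vertex_boundary G S)) / real (card S)) > C)"

definition harmonic :: "'v multigraph \<Rightarrow> ('v \<Rightarrow> real) \<Rightarrow> bool" where
  "harmonic G h \<longleftrightarrow>
     (\<forall>v\<in>verts G. h v = (\<Sum>w\<in>nbrs G v. real (mult G v w) * h w) / real (vertex_degree G v))"

definition liouville :: "'v multigraph \<Rightarrow> bool" where
  "liouville G \<longleftrightarrow>
     \<not> (\<exists>h. harmonic G h \<and> bounded (h ` verts G) \<and> \<not> h constant_on verts G)"

definition uniform_expanders :: "(nat \<Rightarrow> 'v multigraph) \<Rightarrow> bool" where
  "uniform_expanders E \<longleftrightarrow>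
     (\<exists>c::real. c > 0 \<and>
       (\<forall>n S. S \<subseteq> verts (E n) \<and> S \<noteq> {} \<and> real (card S) \<le> 1/2 * real (card (verts (E n))) \<longrightarrow>
          real (card (vertex_boundary (E n) S)) > c * real (card S)))"

definition at_distance :: "'v multigraph \<Rightarrow> 'v \<Rightarrow> nat \<Rightarrow> 'v \<Rightarrow> bool" where
  "at_distance G u n v \<longleftrightarrow>
     (u, v) \<in> {(x, y). y \<in> nbrs G x} ^^ n \<and> (\<forall>k<n. (u, v) \<notin> {(x, y). y \<in> nbrs G x} ^^ k)"

text \<open>The rooted binary tree: vertices are binary words, the root is the empty word, and the two
  children of \<open>u\<close> are \<open>False # u\<close> and \<open>True # u\<close>.\<close>

definition binary_tree :: "bool list multigraph" where
  "binary_tree =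
     \<lparr>verts = UNIV, mult = (\<lambda>u v. if \<exists>b. v = b # u \<or> u = b # v then 1 else 0)\<rparr>"

definition level :: "nat \<Rightarrow> bool list set" where
  "level n = {v \<in> verts binary_tree. at_distance binary_tree [] n v}"

text \<open>Adding the edges of all \<open>E n\<close>.  The sum ranges only over the nonzero summands, of which there
  is at most one if the \<open>E n\<close> live on pairwise disjoint vertex sets.\<close>

definition add_edges :: "'v multigraph \<Rightarrow> (nat \<Rightarrow> 'v multigraph) \<Rightarrow> 'v multigraph" where
  "add_edges T E =
     \<lparr>verts = verts T,
      mult = (\<lambda>u v. mult T u v + (\<Sum>n\<in>{n. mult (E n) u v > 0}. mult (E n) u v))\<rparr>"

lemma nbrs_binary_tree: "nbrs binary_tree u = {v. \<exists>b. v = b # u \<or> u = b # v}"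
  by (auto simp: nbrs_def binary_tree_def)

lemma multigraph_binary_tree: "multigraph binary_tree"
proof
  fix v :: "bool list"
  have "nbrs binary_tree v \<subseteq> {tl v, False # v, True # v}"
    by (auto simp: nbrs_binary_tree)
  then show "finite (nbrs binary_tree v)"
    by (rule finite_subset) simp
qed (auto simp: binary_tree_def)

lemma level_eq: "level n = {v. length v = n}"
proof -
  let ?A = "{(x, y). y \<in> nbrs binary_tree x}"
  have walk_length: "length v \<le> k" if "([], v) \<in> ?A ^^ k" for k v
    using that
    by (induction k arbitrary: v) (fastforce simp: nbrs_binary_tree)+
  have walk: "([], v) \<in> ?A ^^ length v" for v :: "bool list"
    by (induction v) (auto simp: nbrs_binary_tree)
  have "at_distance binary_tree [] n v \<longleftrightarrow> length v = n" for v
  proof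
    assume "at_distance binary_tree [] n v"
    then show "length v = n"
      using walk_length[of v n] walk[of v] unfolding at_distance_def
      by (metis le_neq_implies_less)
  next
    assume "length v = n"
    then show "at_distance binary_tree [] n v"
      using walk_length[of v] walk[of v] unfolding at_distance_def
      by (metis not_le)
  qed
  then show ?thesis
    by (simp add: level_def binary_tree_def)
qed

lemma card_level: "card (level n) = 2 ^ n"
  using card_lists_length_eq[of "UNIV :: bool set" n] by (simp add: level_eq)

lemma multigraph_add_levels:
  assumes "\<And>n. multigraph (E n)" and "\<And>n. verts (E n) = level n"
  shows "multigraph (add_edges binary_tree E)"
proof
  let ?G = "add_edges binary_tree E"
  interpret T: multigraph binary_tree by (rule multigraph_binary_tree)
  show "mult ?G u v = mult ?G v u" for u v
    using T.mult_sym multigraph.mult_sym[OF assms(1), of _ u v] by (simp add: add_edges_def)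
  show "u \<in> verts ?G \<and> v \<in> verts ?G" for u v
    by (simp add: add_edges_def binary_tree_def)
  fix v
  have "n = length v" if "mult (E n) v w > 0" for n w
    using multigraph.mult_verts[OF assms(1) that] by (simp add: assms(2) level_eq)
  then have "{n. mult (E n) v w > 0} = {}" if "mult (E (length v)) v w = 0" for w
    using that by force
  then have "nbrs ?G v \<subseteq> nbrs binary_tree v \<union> nbrs (E (length v)) v"
    by (auto simp: nbrs_def add_edges_def)
  then show "finite (nbrs ?G v)"
    by (rule finite_subset) (simp add: T.locally_finite multigraph.locally_finite[OF assms(1)])
qed

end

theory Submission
  imports Defs
begin

text \<open>
  Every finite set has at least as many children outside it as it has elements, so \<open>T\<close> alone is
  already nonamenable.

  Let \<open>h\<close> be bounded and harmonic.  Averaging the harmonic equation over level \<open>n\<close> turns it into a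
  recurrence for the mean of \<open>h\<close> on the levels, which shows that this mean does not depend on \<open>n\<close>;
  subtract it, so that \<open>h\<close> vanishes at the root and has mean zero on each level.  Multiply the
  harmonic equation by \<open>h\<close> and sum over level \<open>n\<close>.  The edges inside the level are controlled by
  Cheeger's inequality and the tree edges by \<open>2xy \<le> x\<^sup>2 + y\<^sup>2\<close>, and the mean square \<open>a n\<close> of \<open>h\<close> on
  level \<open>n\<close> satisfies \<open>a (n + 2) - a (n + 1) \<ge> (a (n + 1) - a n) / 2 + \<gamma> * a (n + 1)\<close> with a constant
  \<open>\<gamma> > 0\<close>.  As \<open>a 0 = 0\<close>, either \<open>a\<close> vanishes or it grows exponentially, and the latter contradicts
  boundedness.
\<close>

section \<open>Cheeger's inequality for finite regular multigraphs\<close>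

text \<open>A median is the least value of \<open>f\<close> with at most half of \<open>V\<close>
  strictly above it; minimality then bounds the part below.\<close>

lemma exists_median:
  fixes f :: "'a \<Rightarrow> real"
  assumes "finite V" "V \<noteq> {}"
  obtains t where "2 * card {v \<in> V. f v > t} \<le> card V" "2 * card {v \<in> V. f v < t} \<le> card V"
proof -
  define X where "X = {x \<in> f ` V. 2 * card {v \<in> V. f v > x} \<le> card V}"
  define t where "t = Min X"
  have "finite X" using assms by (simp add: X_def)
  have "{v \<in> V. f v > Max (f ` V)} = {}"
    using assms by (auto simp: not_less)
  then have "2 * card {v \<in> V. f v > Max (f ` V)} \<le> card V" by (simp only: card.empty)
  then have "Max (f ` V) \<in> X"
    using assms unfolding X_def by (intro CollectI conjI Max_in) simp_all
  with \<open>finite X\<close> have "t \<in> X" unfolding t_def by (auto intro!: Min_in)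
  have "2 * card {v \<in> V. f v < t} \<le> card V"
  proof (cases "{v \<in> V. f v < t} = {}")
    case False
    \<comment> \<open>The largest value below \<open>t\<close> is outside \<open>X\<close>, so more
      than half of \<open>V\<close> lies above it. The points below \<open>t\<close> are exactly the
      remaining ones.\<close>
    define y where "y = Max (f ` {v \<in> V. f v < t})"
    have y: "y \<in> f ` {v \<in> V. f v < t}"
      unfolding y_def using False assms by (intro Max_in) auto
    have below: "f v \<le> y" if "v \<in> V" "f v < t" for v
      unfolding y_def using assms that by (intro Max_ge) auto
    have "y \<notin> X"
      using y Min_le[OF \<open>finite X\<close>, of y] by (auto simp: t_def)
    with y have "2 * card {v \<in> V. f v > y} > card V" by (auto simp: X_def)
    moreover have "{v \<in> V. f v < t} \<union> {v \<in> V. f v > y} = V"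
      using y below by (auto simp: not_less)
    moreover have "{v \<in> V. f v < t} \<inter> {v \<in> V. f v > y} = {}"
      using below by force
    ultimately show ?thesis
      using card_Un_disjoint[of "{v \<in> V. f v < t}" "{v \<in> V. f v > y}"] assms by simp
  qed (simp only: card.empty)
  with \<open>t \<in> X\<close> show thesis by (intro that) (auto simp: X_def)
qed

context multigraph
begin

lemma sum_nbrs_eq:
  fixes f :: "'v \<Rightarrow> real"
  assumes "finite A" "nbrs G v \<subseteq> A"
  shows "(\<Sum>w\<in>nbrs G v. real (mult G v w) * f w) = (\<Sum>w\<in>A. real (mult G v w) * f w)"
  using assms by (intro sum.mono_neutral_left) (auto simp: nbrs_def)

lemma nbrs_subset_verts: "nbrs G v \<subseteq> verts G"
  using mult_verts by (auto simp: nbrs_def)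

lemma sum_mult_eq_degree:
  assumes "finite (verts G)"
  shows "(\<Sum>w\<in>verts G. real (mult G v w)) = real (vertex_degree G v)"
  using sum_nbrs_eq[OF assms nbrs_subset_verts, of v "\<lambda>_. 1"] by (simp add: vertex_degree_def)

lemma sum_mult_swap:
  fixes F :: "'v \<Rightarrow> 'v \<Rightarrow> real"
  shows "(\<Sum>u\<in>verts G. \<Sum>v\<in>verts G. real (mult G u v) * F u v)
       = (\<Sum>u\<in>verts G. \<Sum>v\<in>verts G. real (mult G u v) * F v u)"
  by (subst sum.swap) (simp add: mult_sym)

lemma sum_mult_regular:
  fixes f :: "'v \<Rightarrow> real"
  assumes "finite (verts G)" "regular d G"
  shows "(\<Sum>u\<in>verts G. \<Sum>v\<in>verts G. real (mult G u v) * f u) = d * (\<Sum>u\<in>verts G. f u)"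
    and "(\<Sum>u\<in>verts G. \<Sum>v\<in>verts G. real (mult G u v) * f v) = d * (\<Sum>u\<in>verts G. f u)"
proof -
  show *: "(\<Sum>u\<in>verts G. \<Sum>v\<in>verts G. real (mult G u v) * f u) = d * (\<Sum>u\<in>verts G. f u)"
    using assms
    by (simp add: sum_distrib_right[symmetric] sum_mult_eq_degree regular_def sum_distrib_left)
  show "(\<Sum>u\<in>verts G. \<Sum>v\<in>verts G. real (mult G u v) * f v) = d * (\<Sum>u\<in>verts G. f u)"
    using sum_mult_swap[of "\<lambda>u v. f v"] * by simp
qed

text \<open>Each boundary vertex has an edge into \<open>S\<close>. The double sum runs over ordered
  pairs and so counts every cut edge twice, whence the factor 2.\<close>

lemma card_boundary_le_cut:
  assumes "finite (verts G)" "S \<subseteq> verts G"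
  shows "2 * real (card (vertex_boundary G S))
    \<le> (\<Sum>u\<in>verts G. \<Sum>v\<in>verts G. real (mult G u v) * (if (u \<in> S) = (v \<in> S) then 0 else 1))"
proof -
  \<comment> \<open>\<open>F\<close> keeps only the orientation from outside \<open>S\<close> to
    inside; the other orientation contributes the same amount by symmetry.\<close>
  define F :: "'v \<Rightarrow> 'v \<Rightarrow> real" where "F u v = (if u \<notin> S \<and> v \<in> S then 1 else 0)" for u v
  have "real (card (vertex_boundary G S))
      = (\<Sum>u\<in>verts G. if u \<in> vertex_boundary G S then 1 else 0)"
    using assms by (subst sum.If_cases) (auto intro!: arg_cong[of _ _ card] simp: vertex_boundary_def)
  also have "\<dots> \<le> (\<Sum>u\<in>verts G. \<Sum>v\<in>verts G. real (mult G u v) * F u v)"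
  proof (intro sum_mono)
    fix u assume "u \<in> verts G"
    show "(if u \<in> vertex_boundary G S then 1 else 0) \<le> (\<Sum>v\<in>verts G. real (mult G u v) * F u v)"
    proof (cases "u \<in> vertex_boundary G S")
      case True
      then obtain v where v: "v \<in> S" "u \<notin> S" "mult G u v > 0"
        by (auto simp: vertex_boundary_def nbrs_def)
      then have "1 \<le> real (mult G u v) * F u v" by (auto simp: F_def)
      also have "\<dots> \<le> (\<Sum>v\<in>verts G. real (mult G u v) * F u v)"
        using assms v by (intro member_le_sum) (auto simp: F_def)
      finally show ?thesis using True by simp
    qed (auto intro!: sum_nonneg simp: F_def)
  qed
  finally have "real (card (vertex_boundary G S))
      \<le> (\<Sum>u\<in>verts G. \<Sum>v\<in>verts G. real (mult G u v) * F u v)" .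
  moreover have "(\<Sum>u\<in>verts G. \<Sum>v\<in>verts G. real (mult G u v) * F u v)
      + (\<Sum>u\<in>verts G. \<Sum>v\<in>verts G. real (mult G u v) * F v u)
      = (\<Sum>u\<in>verts G. \<Sum>v\<in>verts G. real (mult G u v) * (if (u \<in> S) = (v \<in> S) then 0 else 1))"
    unfolding sum.distrib[symmetric] by (intro sum.cong refl) (auto simp: F_def)
  ultimately show ?thesis using sum_mult_swap[of F] by simp
qed

text \<open>Discrete co-area argument: expansion is applied to each superlevel set of
  \<open>f\<close>, all of which lie in the support and so fill at most half of the graph. Induction
  on the size of the support replaces the integral over levels.\<close>

lemma cheeger_L1:
  fixes f :: "'v \<Rightarrow> real"
  assumes fin: "finite (verts G)"
    and expands: "\<And>S. S \<subseteq> verts G \<Longrightarrow> S \<noteq> {} \<Longrightarrow> 2 * card S \<le> card (verts G) \<Longrightarrow>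
      c * real (card S) \<le> real (card (vertex_boundary G S))"
    and "\<And>v. f v \<ge> 0" "2 * card {v \<in> verts G. f v > 0} \<le> card (verts G)"
  shows "2 * c * (\<Sum>v\<in>verts G. f v)
    \<le> (\<Sum>u\<in>verts G. \<Sum>v\<in>verts G. real (mult G u v) * \<bar>f u - f v\<bar>)"
  using assms(3,4)
proof (induction "card {v \<in> verts G. f v > 0}" arbitrary: f rule: less_induct)
  case less
  define S where "S = {v \<in> verts G. f v > 0}"
  have finS: "finite S" and sub: "S \<subseteq> verts G" using fin by (auto simp: S_def)
  show ?case
  proof (cases "S = {}")
    case True
    then have "f v = 0" if "v \<in> verts G" for v
      using that less.prems(1)[of v] by (force simp: S_def)
    then show ?thesis by simp
  next
    case False
    \<comment> \<open>Peel the lowest layer \<open>a * indicator S\<close> off \<open>f\<close>; both sides are additive in it.\<close>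
    define a where "a = Min (f ` S)"
    define g where "g v = (if v \<in> S then f v - a else 0)" for v
    have "a \<in> f ` S" unfolding a_def using False finS by (intro Min_in) auto
    then obtain s where s: "s \<in> S" "f s = a" by auto
    have le: "a \<le> f v" if "v \<in> S" for v using finS that by (simp add: a_def)
    have "a > 0" using s by (auto simp: S_def)
    have f0: "f v = 0" if "v \<in> verts G" "v \<notin> S" for v
      using that less.prems(1)[of v] by (auto simp: S_def)
    have fg: "f v = g v + (if v \<in> S then a else 0)" if "v \<in> verts G" for v
      using that f0 by (simp add: g_def)
    have g0: "g v \<ge> 0" for v using le by (simp add: g_def)
    \<comment> \<open>The minimum is attained at \<open>s\<close>, where \<open>g\<close> vanishes,
      so the support shrinks strictly.\<close>
    have "{v \<in> verts G. g v > 0} \<subset> S"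
      using s by (auto simp: g_def split: if_splits)
    then have lt: "card {v \<in> verts G. g v > 0} < card S"
      using finS by (rule psubset_card_mono[rotated])
    have IH: "2 * c * (\<Sum>v\<in>verts G. g v)
        \<le> (\<Sum>u\<in>verts G. \<Sum>v\<in>verts G. real (mult G u v) * \<bar>g u - g v\<bar>)"
      using less.hyps[of g] lt g0 less.prems(2) by (fastforce simp: S_def)
    have cut: "2 * (c * real (card S))
        \<le> (\<Sum>u\<in>verts G. \<Sum>v\<in>verts G. real (mult G u v) * (if (u \<in> S) = (v \<in> S) then 0 else 1))"
      using card_boundary_le_cut[OF fin sub] expands[OF sub False] less.prems(2)
      by (simp add: S_def)
    have "(\<Sum>v\<in>verts G. if v \<in> S then a else 0) = a * card S"
      using fin sub by (simp add: sum.If_cases Int_absorb1)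
    then have "2 * c * (\<Sum>v\<in>verts G. f v)
        = 2 * c * (\<Sum>v\<in>verts G. g v) + a * (2 * (c * card S))"
      by (simp add: fg sum.distrib algebra_simps)
    also have "\<dots> \<le> (\<Sum>u\<in>verts G. \<Sum>v\<in>verts G. real (mult G u v) * \<bar>g u - g v\<bar>)
        + a * (\<Sum>u\<in>verts G. \<Sum>v\<in>verts G. real (mult G u v) * (if (u \<in> S) = (v \<in> S) then 0 else 1))"
      using IH mult_left_mono[OF cut less_imp_le[OF \<open>a > 0\<close>]] by (rule add_mono)
    also have "\<dots> = (\<Sum>u\<in>verts G. \<Sum>v\<in>verts G. real (mult G u v) * \<bar>f u - f v\<bar>)"
      unfolding sum_distrib_left sum.distrib[symmetric]
    proof (intro sum.cong refl)
      fix u v assume "u \<in> verts G" "v \<in> verts G"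
      \<comment> \<open>If exactly one of \<open>u\<close>, \<open>v\<close> is in \<open>S\<close>,
        both functions vanish at the other one, and \<open>f - a\<close> is nonnegative on
        \<open>S\<close>; hence no cancellation occurs.\<close>
      then have "\<bar>f u - f v\<bar> = \<bar>g u - g v\<bar> + a * (if (u \<in> S) = (v \<in> S) then 0 else 1)"
        using le[of u] le[of v] f0[of u] f0[of v] \<open>a > 0\<close> by (auto simp: g_def)
      then show "real (mult G u v) * \<bar>g u - g v\<bar>
          + a * (real (mult G u v) * (if (u \<in> S) = (v \<in> S) then 0 else 1))
          = real (mult G u v) * \<bar>f u - f v\<bar>"
        by (simp add: algebra_simps)
    qed
    finally show ?thesis .
  qed
qed

text \<open>The L1 inequality is applied to the square of \<open>g\<close>. Factoring a difference
  of squares and using weighted AM-GM bounds the result by the Dirichlet sum plus a multiple of the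
  L2 norm that the left side absorbs.\<close>

lemma cheeger_half_support:
  fixes g :: "'v \<Rightarrow> real"
  assumes fin: "finite (verts G)" and reg: "regular d G" and "d > 0" and "c > 0"
    and expands: "\<And>S. S \<subseteq> verts G \<Longrightarrow> S \<noteq> {} \<Longrightarrow> 2 * card S \<le> card (verts G) \<Longrightarrow>
      c * real (card S) \<le> real (card (vertex_boundary G S))"
    and "\<And>v. g v \<ge> 0" and supp: "2 * card {v \<in> verts G. g v > 0} \<le> card (verts G)"
  shows "c\<^sup>2 / d * (\<Sum>v\<in>verts G. (g v)\<^sup>2)
    \<le> (\<Sum>u\<in>verts G. \<Sum>v\<in>verts G. real (mult G u v) * (g u - g v)\<^sup>2)" (is "_ \<le> ?D")
proof -
  \<comment> \<open>AM-GM weight: the argument gives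
    \<open>?D \<ge> 2 * e * (2 * c - 2 * e * d) * ?A\<close>, and this \<open>e\<close> maximises
    the factor, with value \<open>c\<^sup>2 / d\<close>.\<close>
  define e where "e = c / (2 * d)"
  have "e > 0" using assms by (simp add: e_def)
  let ?A = "\<Sum>v\<in>verts G. (g v)\<^sup>2"
  have "{v \<in> verts G. (g v)\<^sup>2 > 0} = {v \<in> verts G. g v > 0}"
    using assms(6) by (auto simp: less_le)
  then have "2 * c * ?A
      \<le> (\<Sum>u\<in>verts G. \<Sum>v\<in>verts G. real (mult G u v) * \<bar>(g u)\<^sup>2 - (g v)\<^sup>2\<bar>)"
    using supp by (intro cheeger_L1[OF fin expands]) auto
  also have "\<dots> \<le> (\<Sum>u\<in>verts G. \<Sum>v\<in>verts G. 1 / (2 * e) * (real (mult G u v) * (g u - g v)\<^sup>2)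
      + (e * (real (mult G u v) * (g u)\<^sup>2) + e * (real (mult G u v) * (g v)\<^sup>2)))"
  proof (intro sum_mono)
    fix u v
    have "\<bar>(g u)\<^sup>2 - (g v)\<^sup>2\<bar> = \<bar>g u - g v\<bar> * (g u + g v)"
      using assms(6)[of u] assms(6)[of v]
      by (simp add: power2_eq_square square_diff_square_factored abs_mult)
    also have "\<dots> \<le> (g u - g v)\<^sup>2 * (1 / (2 * e)) + (g u + g v)\<^sup>2 * (e / 2)"
    proof -
      have "0 \<le> (\<bar>g u - g v\<bar> - e * (g u + g v))\<^sup>2 / (2 * e)" using \<open>e > 0\<close> by simp
      also have "\<dots> = (g u - g v)\<^sup>2 * (1 / (2 * e)) + (g u + g v)\<^sup>2 * (e / 2)
          - \<bar>g u - g v\<bar> * (g u + g v)"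
        using \<open>e > 0\<close> unfolding power2_diff by (simp add: field_simps power2_eq_square)
      finally show ?thesis by simp
    qed
    also have "(g u + g v)\<^sup>2 * (e / 2) \<le> (2 * (g u)\<^sup>2 + 2 * (g v)\<^sup>2) * (e / 2)"
      using \<open>e > 0\<close> sum_squares_bound[of "g u" "g v"]
      by (intro mult_right_mono) (auto simp: power2_sum)
    finally have "\<bar>(g u)\<^sup>2 - (g v)\<^sup>2\<bar>
        \<le> (g u - g v)\<^sup>2 * (1 / (2 * e)) + ((g u)\<^sup>2 * e + (g v)\<^sup>2 * e)"
      by (simp add: algebra_simps)
    from mult_left_mono[OF this, of "real (mult G u v)"]
    show "real (mult G u v) * \<bar>(g u)\<^sup>2 - (g v)\<^sup>2\<bar>
      \<le> 1 / (2 * e) * (real (mult G u v) * (g u - g v)\<^sup>2)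
        + (e * (real (mult G u v) * (g u)\<^sup>2) + e * (real (mult G u v) * (g v)\<^sup>2))"
      by (simp add: algebra_simps)
  qed
  also have "\<dots> = 1 / (2 * e) * ?D + (e * (d * ?A) + e * (d * ?A))"
    unfolding sum.distrib sum_distrib_left[symmetric] sum_mult_regular[OF fin reg] ..
  finally have "2 * c * ?A * e \<le> (1 / (2 * e) * ?D + (e * (d * ?A) + e * (d * ?A))) * e"
    using \<open>e > 0\<close> by (intro mult_right_mono) auto
  then show ?thesis
    using assms(3,4) by (simp add: e_def field_simps power2_eq_square)
qed

text \<open>Subtracting a median \<open>t\<close> leaves positive and negative parts
  \<open>p\<close> and \<open>q\<close> that are each supported on at most half of the vertices, so
  the half-support case applies to both.\<close>

lemma cheeger:
  fixes f :: "'v \<Rightarrow> real"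
  assumes fin: "finite (verts G)" and reg: "regular d G" and "d > 0" and "c > 0"
    and expands: "\<And>S. S \<subseteq> verts G \<Longrightarrow> S \<noteq> {} \<Longrightarrow> 2 * card S \<le> card (verts G) \<Longrightarrow>
      c * real (card S) \<le> real (card (vertex_boundary G S))"
    and mean: "(\<Sum>v\<in>verts G. f v) = 0"
  shows "c\<^sup>2 / d * (\<Sum>v\<in>verts G. (f v)\<^sup>2)
    \<le> (\<Sum>u\<in>verts G. \<Sum>v\<in>verts G. real (mult G u v) * (f u - f v)\<^sup>2)"
proof (cases "verts G = {}")
  case False
  obtain t where t: "2 * card {v \<in> verts G. f v > t} \<le> card (verts G)"
      "2 * card {v \<in> verts G. f v < t} \<le> card (verts G)"
    using exists_median[OF fin False] .
  define p where "p v = max 0 (f v - t)" for v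
  define q where "q v = max 0 (t - f v)" for v
  have "{v \<in> verts G. p v > 0} = {v \<in> verts G. f v > t}"
    and "{v \<in> verts G. q v > 0} = {v \<in> verts G. f v < t}"
    by (auto simp: p_def q_def)
  then have *: "c\<^sup>2 / d * (\<Sum>v\<in>verts G. (p v)\<^sup>2)
        \<le> (\<Sum>u\<in>verts G. \<Sum>v\<in>verts G. real (mult G u v) * (p u - p v)\<^sup>2)"
      "c\<^sup>2 / d * (\<Sum>v\<in>verts G. (q v)\<^sup>2)
        \<le> (\<Sum>u\<in>verts G. \<Sum>v\<in>verts G. real (mult G u v) * (q u - q v)\<^sup>2)"
    using t by (intro cheeger_half_support assms; simp add: p_def q_def)+
  \<comment> \<open>As \<open>f\<close> has mean zero, shifting it by \<open>t\<close> can only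
    increase its L2 norm.\<close>
  have "(\<Sum>v\<in>verts G. (f v)\<^sup>2) \<le> (\<Sum>v\<in>verts G. (f v)\<^sup>2) - 2 * t * (\<Sum>v\<in>verts G. f v)
      + real (card (verts G)) * t\<^sup>2"
    by (simp add: mean)
  also have "\<dots> = (\<Sum>v\<in>verts G. (f v)\<^sup>2 - 2 * t * f v + t\<^sup>2)"
    by (simp add: sum.distrib sum_subtractf sum_distrib_left)
  also have "\<dots> = (\<Sum>v\<in>verts G. (p v)\<^sup>2 + (q v)\<^sup>2)"
    by (intro sum.cong) (auto simp: p_def q_def max_def power2_eq_square algebra_simps)
  also have "\<dots> = (\<Sum>v\<in>verts G. (p v)\<^sup>2) + (\<Sum>v\<in>verts G. (q v)\<^sup>2)"
    by (rule sum.distrib)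
  finally have "c\<^sup>2 / d * (\<Sum>v\<in>verts G. (f v)\<^sup>2)
      \<le> c\<^sup>2 / d * ((\<Sum>v\<in>verts G. (p v)\<^sup>2) + (\<Sum>v\<in>verts G. (q v)\<^sup>2))"
    by (intro mult_left_mono) auto
  also have "\<dots> \<le> (\<Sum>u\<in>verts G. \<Sum>v\<in>verts G. real (mult G u v) * (p u - p v)\<^sup>2)
      + (\<Sum>u\<in>verts G. \<Sum>v\<in>verts G. real (mult G u v) * (q u - q v)\<^sup>2)"
    using * unfolding distrib_left by (rule add_mono)
  also have "\<dots> \<le> (\<Sum>u\<in>verts G. \<Sum>v\<in>verts G. real (mult G u v) * (f u - f v)\<^sup>2)"
    unfolding sum.distrib[symmetric] distrib_left[symmetric]
  proof (intro sum_mono mult_left_mono)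
    fix u v
    \<comment> \<open>\<open>p\<close> and \<open>q\<close> are never both nonzero at one vertex, so
      only mixed products survive, and these have the favourable sign.\<close>
    have "(f u - f v)\<^sup>2 = (p u - p v)\<^sup>2 + (q u - q v)\<^sup>2 + 2 * (p u * q v + p v * q u)"
      by (simp add: p_def q_def max_def power2_eq_square algebra_simps)
    moreover have "p u * q v + p v * q u \<ge> 0" by (simp add: p_def q_def)
    ultimately show "(p u - p v)\<^sup>2 + (q u - q v)\<^sup>2 \<le> (f u - f v)\<^sup>2" by simp
  qed simp
  finally show ?thesis .
qed simp

end

section \<open>Sums over the levels of the tree\<close>

lemma finite_level: "finite (level n)"
  using card_level[of n] by (intro card_ge_0_finite) simp

lemma level_0: "level 0 = {[]}"
  by (auto simp: level_eq)

lemma sum_level_Suc: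
  fixes f :: "bool list \<Rightarrow> real"
  shows "(\<Sum>v\<in>level (Suc n). f v) = (\<Sum>v\<in>level n. f (False # v) + f (True # v))"
proof -
  have "level (Suc n) = Cons False ` level n \<union> Cons True ` level n"
    by (auto simp: level_eq length_Suc_conv image_iff)
  moreover have "Cons False ` level n \<inter> Cons True ` level n = {}" by auto
  ultimately show ?thesis
    by (simp add: sum.union_disjoint finite_level sum.reindex sum.distrib)
qed

section \<open>The binary tree with graphs on its levels\<close>

locale tree_with_levels =
  fixes E :: "nat \<Rightarrow> bool list multigraph"
  assumes graph: "multigraph (E n)"
    and verts_E: "verts (E n) = level n"
    and regular_E: "regular 3 (E n)"
begin

abbreviation "\<G> \<equiv> add_edges binary_tree E"

lemma verts_G: "verts \<G> = UNIV"
  by (simp add: add_edges_def binary_tree_def)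

text \<open>The levels are disjoint, so among all \<open>E n\<close> only the one on the level of
  \<open>v\<close> can have an edge at \<open>v\<close>.\<close>

lemma mult_G: "mult \<G> v w = mult binary_tree v w + mult (E (length v)) v w"
proof -
  have *: "n = length v" if "mult (E n) v w > 0" for n
    using multigraph.mult_verts[OF graph that] by (simp add: verts_E level_eq)
  have "{n. mult (E n) v w > 0} = (if mult (E (length v)) v w > 0 then {length v} else {})"
    by (intro set_eqI) (metis * empty_iff mem_Collect_eq singleton_iff)
  then show ?thesis by (simp add: add_edges_def)
qed

text \<open>The root needs its own case: \<open>tl [] = []\<close> would otherwise count the root as
  its own parent.\<close>

lemma tree_sum:
  fixes f :: "bool list \<Rightarrow> real"
  assumes "finite A" "nbrs binary_tree v \<subseteq> A"
  shows "(\<Sum>w\<in>A. real (mult binary_tree v w) * f w)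
    = f (False # v) + f (True # v) + (if v = [] then 0 else f (tl v))"
proof -
  interpret T: multigraph binary_tree by (rule multigraph_binary_tree)
  have nbrs: "nbrs binary_tree v = {False # v, True # v} \<union> (if v = [] then {} else {tl v})"
    by (cases v) (auto simp: nbrs_binary_tree)
  have one: "mult binary_tree v w = 1" if "w \<in> nbrs binary_tree v" for w
    using that by (auto simp: nbrs_def binary_tree_def split: if_splits)
  have neq: "tl v \<noteq> b # v" for b
    by (cases v) (auto dest: arg_cong[of _ _ length])
  have "(\<Sum>w\<in>A. real (mult binary_tree v w) * f w) = (\<Sum>w\<in>nbrs binary_tree v. f w)"
    unfolding T.sum_nbrs_eq[OF assms, symmetric] by (intro sum.cong refl) (simp add: one)
  also have "\<dots> = f (False # v) + f (True # v) + (if v = [] then 0 else f (tl v))"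
    unfolding nbrs by (simp add: neq[symmetric])
  finally show ?thesis .
qed

lemma nbr_sum:
  fixes f :: "bool list \<Rightarrow> real"
  shows "(\<Sum>w\<in>nbrs \<G> v. real (mult \<G> v w) * f w)
    = (\<Sum>w\<in>level (length v). real (mult (E (length v)) v w) * f w)
      + (f (False # v) + f (True # v) + (if v = [] then 0 else f (tl v)))"
proof -
  interpret T: multigraph binary_tree by (rule multigraph_binary_tree)
  interpret E: multigraph "E (length v)" by (rule graph)
  interpret G: multigraph \<G> by (rule multigraph_add_levels[OF graph verts_E])
  \<comment> \<open>One finite index set containing all the neighbourhoods involved, so that the sum
    can be split according to \<open>mult_G\<close>.\<close>
  define A where "A = nbrs \<G> v \<union> nbrs binary_tree v \<union> level (length v)"
  have A: "finite A" "nbrs \<G> v \<subseteq> A" "nbrs binary_tree v \<subseteq> A" "nbrs (E (length v)) v \<subseteq> A"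
    using E.nbrs_subset_verts[of v]
    by (auto simp: A_def G.locally_finite T.locally_finite finite_level verts_E)
  have "(\<Sum>w\<in>A. real (mult (E (length v)) v w) * f w)
      = (\<Sum>w\<in>level (length v). real (mult (E (length v)) v w) * f w)"
    using E.sum_nbrs_eq[OF A(1,4), of f] E.sum_nbrs_eq[of "level (length v)" v f]
      E.nbrs_subset_verts[of v] by (simp add: finite_level verts_E)
  then show ?thesis
    unfolding G.sum_nbrs_eq[OF A(1,2)] unfolding mult_G
    by (simp add: distrib_right sum.distrib tree_sum[OF A(1,3)])
qed

lemma level_degree: "(\<Sum>w\<in>level (length v). real (mult (E (length v)) v w)) = 3"
proof -
  have "v \<in> level (length v)" by (simp add: level_eq)
  then show ?thesis
    using multigraph.sum_mult_eq_degree[OF graph, of "length v" v] regular_E[of "length v"]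
    by (simp add: verts_E finite_level regular_def)
qed

lemma degree_G: "vertex_degree \<G> v = (if v = [] then 5 else 6)"
proof -
  have "real (vertex_degree \<G> v) = (if v = [] then 5 else 6)"
    using nbr_sum[of v "\<lambda>_. 1"] level_degree[of v] by (simp add: vertex_degree_def)
  then show ?thesis by (simp split: if_splits)
qed

lemma bounded_degree_G: "bounded_degree \<G>"
  unfolding bounded_degree_def by (intro exI[of _ 6]) (simp add: degree_G)

section \<open>Nonamenability\<close>

text \<open>The elements of \<open>S\<close> have twice as many distinct children as there are
  elements, and at most \<open>card S\<close> of these lie in \<open>S\<close>; the others are
  boundary vertices.\<close>

lemma card_boundary_ge:
  assumes "finite S"
  shows "card S \<le> card (vertex_boundary \<G> S)"
proof -
  interpret G: multigraph \<G> by (rule multigraph_add_levels[OF graph verts_E])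
  define C where "C = Cons False ` S \<union> Cons True ` S"
  have "card C = card S + card S"
    unfolding C_def using assms
    by (subst card_Un_disjoint) (auto simp: card_image)
  moreover have "C - S \<subseteq> vertex_boundary \<G> S"
  proof
    fix v assume v: "v \<in> C - S"
    then obtain u b where u: "u \<in> S" "v = b # u" by (auto simp: C_def)
    then have "mult binary_tree v u > 0" by (auto simp: binary_tree_def)
    then have "u \<in> nbrs \<G> v" by (simp add: nbrs_def mult_G)
    with u v show "v \<in> vertex_boundary \<G> S"
      by (auto simp: vertex_boundary_def verts_G)
  qed
  \<comment> \<open>Needed because \<open>card\<close> of an infinite set is 0; local finiteness
    supplies it.\<close>
  moreover have "finite (vertex_boundary \<G> S)"
  proof (rule finite_subset)
    show "vertex_boundary \<G> S \<subseteq> (\<Union>u\<in>S. nbrs \<G> u)"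
      using G.mult_sym by (fastforce simp: vertex_boundary_def nbrs_def)
  qed (use assms G.locally_finite in auto)
  ultimately show ?thesis
    using card_mono[of "vertex_boundary \<G> S" "C - S"] diff_card_le_card_Diff[OF assms, of C]
    by linarith
qed

lemma nonamenable_G: "nonamenable \<G>"
  unfolding nonamenable_def
proof (intro conjI exI[of _ "1/2"])
  show "infinite (verts \<G>)" by (simp add: verts_G infinite_UNIV_listI)
  have "1 \<le> (INF S\<in>{S. S \<subseteq> verts \<G> \<and> finite S \<and> S \<noteq> {}}.
      real (card (vertex_boundary \<G> S)) / real (card S))"
  proof (rule cINF_greatest)
    show "{S. S \<subseteq> verts \<G> \<and> finite S \<and> S \<noteq> {}} \<noteq> {}"
      by (auto simp: verts_G intro!: exI[of _ "{[]}"])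
    fix S assume "S \<in> {S. S \<subseteq> verts \<G> \<and> finite S \<and> S \<noteq> {}}"
    then show "1 \<le> real (card (vertex_boundary \<G> S)) / real (card S)"
      using card_boundary_ge[of S] by (simp add: card_gt_0_iff)
  qed
  then show "1 / 2 < (INF S\<in>{S. S \<subseteq> verts \<G> \<and> finite S \<and> S \<noteq> {}}.
      real (card (vertex_boundary \<G> S)) / real (card S))"
    by linarith
qed simp

section \<open>Harmonic functions: level means and mean squares\<close>

lemma harmonic_G_iff:
  "harmonic \<G> h \<longleftrightarrow> (\<forall>v. (if v = [] then 5 else 6) * h v
    = (\<Sum>w\<in>level (length v). real (mult (E (length v)) v w) * h w)
      + (h (False # v) + h (True # v) + (if v = [] then 0 else h (tl v))))"
proof -
  have "h v = x / real (vertex_degree \<G> v) \<longleftrightarrow> (if v = [] then 5 else 6) * h v = x" for v x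
    by (auto simp: degree_G field_simps)
  then show ?thesis
    unfolding harmonic_def verts_G nbr_sum by (simp only: ball_UNIV)
qed

lemma harmonic_diff_const:
  assumes "harmonic \<G> h"
  shows "harmonic \<G> (\<lambda>v. h v - c)"
  unfolding harmonic_G_iff
proof
  fix v
  have *: "(\<Sum>w\<in>level (length v). real (mult (E (length v)) v w) * (h w - c))
      = (\<Sum>w\<in>level (length v). real (mult (E (length v)) v w) * h w) - 3 * c"
    unfolding right_diff_distrib sum_subtractf sum_distrib_right[symmetric] level_degree ..
  show "(if v = [] then 5 else 6) * (h v - c)
    = (\<Sum>w\<in>level (length v). real (mult (E (length v)) v w) * (h w - c))
      + (h (False # v) - c + (h (True # v) - c) + (if v = [] then 0 else h (tl v) - c))"
    unfolding * using spec[OF assms[unfolded harmonic_G_iff], of v]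
    by (auto simp: right_diff_distrib)
qed

lemma level_sum_edges:
  fixes f :: "bool list \<Rightarrow> real"
  shows "(\<Sum>u\<in>level n. \<Sum>v\<in>level n. real (mult (E n) u v) * f u) = 3 * (\<Sum>u\<in>level n. f u)"
    and "(\<Sum>u\<in>level n. \<Sum>v\<in>level n. real (mult (E n) u v) * f v) = 3 * (\<Sum>u\<in>level n. f u)"
  using multigraph.sum_mult_regular[OF graph, of n 3 f] regular_E
  by (simp_all add: verts_E finite_level)

lemma harmonic_root:
  assumes "harmonic \<G> h"
  shows "h [False] + h [True] = 2 * h []"
proof -
  \<comment> \<open>A 3-regular graph on the single root consists of three loops, which cancel 3 of
    the 5 units of degree.\<close>
  have "real (mult (E 0) [] []) = 3"
    using level_degree[of "[]"] by (simp add: level_0)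
  with assms show ?thesis
    unfolding harmonic_G_iff by (auto simp: level_0 dest!: spec[of _ "[]"])
qed

lemma harmonic_at_level:
  assumes "harmonic \<G> h" "v \<in> level (Suc n)"
  shows "6 * h v = (\<Sum>w\<in>level (Suc n). real (mult (E (Suc n)) v w) * h w)
      + (h (False # v) + h (True # v)) + h (tl v)"
proof -
  have "length v = Suc n" "v \<noteq> []" using assms(2) by (auto simp: level_eq)
  then show ?thesis
    using assms(1) unfolding harmonic_G_iff by (auto dest!: spec[of _ v])
qed

text \<open>Level sums \<open>s\<close> satisfy \<open>s (n + 2) = 3 * s (n + 1) - 2 * s n\<close>,
  with characteristic roots 1 and 2; the equation at the root excludes the constant mode.\<close>

lemma harmonic_level_mean:
  assumes "harmonic \<G> h"
  shows "(\<Sum>v\<in>level n. h v) = 2 ^ n * h []"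
proof -
  \<comment> \<open>The recurrence has order two, so the induction carries two consecutive
    levels.\<close>
  have "(\<Sum>v\<in>level n. h v) = 2 ^ n * h [] \<and> (\<Sum>v\<in>level (Suc n). h v) = 2 ^ Suc n * h []"
  proof (induction n)
    case 0
    show ?case using harmonic_root[OF assms] by (simp add: level_0 sum_level_Suc)
  next
    case (Suc n)
    have "6 * (\<Sum>v\<in>level (Suc n). h v)
        = (\<Sum>v\<in>level (Suc n). (\<Sum>w\<in>level (Suc n). real (mult (E (Suc n)) v w) * h w)
          + (h (False # v) + h (True # v)) + h (tl v))"
      unfolding sum_distrib_left by (intro sum.cong refl harmonic_at_level assms)
    also have "\<dots> = 3 * (\<Sum>v\<in>level (Suc n). h v) + (\<Sum>v\<in>level (Suc (Suc n)). h v)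
          + 2 * (\<Sum>v\<in>level n. h v)"
      unfolding sum.distrib level_sum_edges sum_level_Suc[of _ "Suc n"]
        sum_level_Suc[of "\<lambda>v. h (tl v)"] by simp
    finally show ?case using Suc by (simp add: algebra_simps)
  qed
  then show ?thesis by blast
qed

text \<open>The harmonic equation times \<open>2 * h v\<close>, summed over a level. Of the 12 units
  of \<open>?A\<close>, level edges use at most \<open>6 - \<gamma>\<close> by \<open>gap\<close>,
  and AM-GM on the three tree edges at each vertex uses 3.\<close>

lemma harmonic_level_square:
  assumes "harmonic \<G> h"
    and gap: "\<gamma> * (\<Sum>v\<in>level (Suc n). (h v)\<^sup>2)
      \<le> (\<Sum>u\<in>level (Suc n). \<Sum>v\<in>level (Suc n). real (mult (E (Suc n)) u v) * (h u - h v)\<^sup>2)"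
  shows "(3 + \<gamma>) * (\<Sum>v\<in>level (Suc n). (h v)\<^sup>2)
    \<le> (\<Sum>v\<in>level (Suc (Suc n)). (h v)\<^sup>2) + 2 * (\<Sum>v\<in>level n. (h v)\<^sup>2)"
proof -
  let ?L = "level (Suc n)" and ?m = "\<lambda>u v. real (mult (E (Suc n)) u v)"
  let ?A = "\<Sum>v\<in>level (Suc n). (h v)\<^sup>2"
  have edges: "(\<Sum>u\<in>?L. \<Sum>v\<in>?L. ?m u v * (h u - h v)\<^sup>2)
      = 6 * ?A - 2 * (\<Sum>u\<in>?L. \<Sum>v\<in>?L. ?m u v * h v * h u)"
  proof -
    have "(\<Sum>u\<in>?L. \<Sum>v\<in>?L. ?m u v * (h u - h v)\<^sup>2)
        = (\<Sum>u\<in>?L. \<Sum>v\<in>?L. ?m u v * (h u)\<^sup>2 + ?m u v * (h v)\<^sup>2 - 2 * (?m u v * h v * h u))"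
      by (simp add: power2_diff algebra_simps)
    then show ?thesis
      by (simp add: sum.distrib sum_subtractf level_sum_edges flip: sum_distrib_left)
  qed
  have "12 * ?A = (\<Sum>v\<in>?L. 2 * (6 * h v * h v))"
    by (simp add: sum_distrib_left power2_eq_square)
  also have "\<dots> = (\<Sum>v\<in>?L. 2 * (((\<Sum>w\<in>?L. ?m v w * h w) + (h (False # v) + h (True # v))
      + h (tl v)) * h v))"
    by (intro sum.cong refl) (simp only: harmonic_at_level[OF assms(1)])
  also have "\<dots> \<le> (\<Sum>v\<in>?L. 2 * (\<Sum>w\<in>?L. ?m v w * h w * h v)
      + (3 * (h v)\<^sup>2 + ((h (False # v))\<^sup>2 + (h (True # v))\<^sup>2) + (h (tl v))\<^sup>2))"
  proof (intro sum_mono)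
    fix v
    show "2 * (((\<Sum>w\<in>?L. ?m v w * h w) + (h (False # v) + h (True # v)) + h (tl v)) * h v)
      \<le> 2 * (\<Sum>w\<in>?L. ?m v w * h w * h v)
      + (3 * (h v)\<^sup>2 + ((h (False # v))\<^sup>2 + (h (True # v))\<^sup>2) + (h (tl v))\<^sup>2)"
      using sum_squares_bound[of "h (False # v)" "h v"] sum_squares_bound[of "h (True # v)" "h v"]
        sum_squares_bound[of "h (tl v)" "h v"]
      by (simp add: distrib_right flip: sum_distrib_right)
  qed
  \<comment> \<open>\<open>tl\<close> maps this level two-to-one onto the previous one, hence the
    last factor 2.\<close>
  also have "\<dots> = 2 * (\<Sum>u\<in>?L. \<Sum>v\<in>?L. ?m u v * h v * h u)
      + (3 * ?A + (\<Sum>v\<in>level (Suc (Suc n)). (h v)\<^sup>2) + 2 * (\<Sum>v\<in>level n. (h v)\<^sup>2))"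
    unfolding sum.distrib sum_distrib_left[symmetric] sum_level_Suc[of _ "Suc n"]
      sum_level_Suc[of "\<lambda>v. (h (tl v))\<^sup>2"] by simp
  finally show ?thesis using gap edges by (simp add: distrib_right)
qed

end

section \<open>Exponential growth and the Liouville property\<close>

lemma bounded_seq_eq_0_of_growth:
  fixes a :: "nat \<Rightarrow> real"
  assumes "a 0 = 0" "\<And>n. a n \<ge> 0" "\<And>n. a n \<le> B" "\<gamma> > 0"
    and rec: "\<And>n. a (Suc (Suc n)) - a (Suc n) \<ge> (a (Suc n) - a n) / 2 + \<gamma> * a (Suc n)"
  shows "a n = 0"
proof (rule ccontr)
  assume "a n \<noteq> 0"
  have mono: "a k \<le> a (Suc k)" for k
  proof (induction k)
    case (Suc k)
    moreover have "\<gamma> * a (Suc k) \<ge> 0" using assms by simp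
    ultimately show ?case using rec[of k] by argo
  qed (simp add: assms)
  have "a n > 0" using assms(2)[of n] \<open>a n \<noteq> 0\<close> by linarith
  \<comment> \<open>The recurrence controls growth only from index 1 on; \<open>a 0 = 0\<close>
    ensures that \<open>n\<close> is not 0.\<close>
  then obtain m where m: "n = Suc m" using assms(1) by (cases n) auto
  have "a (n + k) \<ge> (1 + \<gamma>) ^ k * a n" for k
  proof (induction k)
    case (Suc k)
    have "(1 + \<gamma>) ^ Suc k * a n \<le> (1 + \<gamma>) * a (n + k)"
      using Suc \<open>\<gamma> > 0\<close> by (simp add: mult.assoc)
    also have "\<dots> = a (Suc (m + k)) + \<gamma> * a (Suc (m + k))"
      by (simp add: m algebra_simps)
    also have "\<dots> \<le> a (n + Suc k)"
      using rec[of "m + k"] mono[of "m + k"] unfolding m add_Suc add_Suc_right by argo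
    finally show ?case .
  qed simp
  then have "(1 + \<gamma>) ^ k \<le> B / a n" for k
    using \<open>a n > 0\<close> assms(3)[of "n + k"] by (simp add: field_simps) (metis order_trans mult.commute)
  moreover obtain k where "(1 + \<gamma>) ^ k > B / a n"
    using real_arch_pow[of "1 + \<gamma>"] \<open>\<gamma> > 0\<close> by auto
  ultimately show False by (meson not_less)
qed

context tree_with_levels
begin

lemma bounded_harmonic_eq_0:
  assumes unif: "uniform_expanders E"
    and harm: "harmonic \<G> h" and bdd: "\<And>v. \<bar>h v\<bar> \<le> B" and root: "h [] = 0"
  shows "h v = 0"
proof -
  obtain c :: real where "c > 0"
    and exp: "\<And>n S. S \<subseteq> level n \<Longrightarrow> S \<noteq> {} \<Longrightarrow> real (card S) \<le> 1/2 * real (card (level n)) \<Longrightarrow>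
      real (card (vertex_boundary (E n) S)) > c * real (card S)"
    using unif unfolding uniform_expanders_def verts_E by metis
  \<comment> \<open>The constant in \<open>cheeger\<close> for degree 3, the same for all
    levels.\<close>
  define \<gamma> where "\<gamma> = c\<^sup>2 / 3"
  have "\<gamma> > 0" using \<open>c > 0\<close> by (simp add: \<gamma>_def)
  define a where "a n = (\<Sum>v\<in>level n. (h v)\<^sup>2) / 2 ^ n" for n
  have gap: "\<gamma> * (\<Sum>v\<in>level n. (h v)\<^sup>2)
      \<le> (\<Sum>u\<in>level n. \<Sum>v\<in>level n. real (mult (E n) u v) * (h u - h v)\<^sup>2)" for n
  proof -
    interpret E: multigraph "E n" by (rule graph)
    have "c * real (card S) \<le> real (card (vertex_boundary (E n) S))"
      if "S \<subseteq> verts (E n)" "S \<noteq> {}" "2 * card S \<le> card (verts (E n))" for S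
      using exp[of S n] that by (simp add: verts_E)
    \<comment> \<open>Since \<open>h [] = 0\<close>, every level sum of \<open>h\<close> vanishes,
      as \<open>cheeger\<close> requires.\<close>
    then show ?thesis
      using E.cheeger[of 3 c h] \<open>c > 0\<close> regular_E harmonic_level_mean[OF harm, of n] root
      by (simp add: verts_E finite_level \<gamma>_def)
  qed
  have sq: "(h v)\<^sup>2 \<le> B\<^sup>2" for v
    using bdd[of v] by (metis abs_ge_zero power2_abs power_mono)
  have "a n = 0" for n
  proof (rule bounded_seq_eq_0_of_growth)
    show "a 0 = 0" by (simp add: a_def level_0 root)
    show "a n \<ge> 0" for n by (simp add: a_def sum_nonneg)
    show "a n \<le> B\<^sup>2" for n
      using sum_bounded_above[of "level n" "\<lambda>v. (h v)\<^sup>2" "B\<^sup>2"] sq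
      by (simp add: a_def card_level divide_le_eq mult.commute)
    \<comment> \<open>Normalising by \<open>2 ^ n\<close> turns the level inequality into one with
      coefficients \<open>2 * (3 + \<gamma>)\<close>, 4 and 2; division by 4 leaves
      \<open>\<gamma> / 2\<close>.\<close>
    show "\<gamma> / 2 > 0" using \<open>\<gamma> > 0\<close> by simp
    show "a (Suc (Suc n)) - a (Suc n) \<ge> (a (Suc n) - a n) / 2 + \<gamma> / 2 * a (Suc n)" for n
    proof -
      have "(\<Sum>v\<in>level n. (h v)\<^sup>2) = 2 ^ n * a n" for n by (simp add: a_def)
      then have "2 ^ n * (2 * (3 + \<gamma>) * a (Suc n)) \<le> 2 ^ n * (4 * a (Suc (Suc n)) + 2 * a n)"
        using harmonic_level_square[OF harm gap, of n] by (simp add: algebra_simps)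
      then have "2 * (3 + \<gamma>) * a (Suc n) \<le> 4 * a (Suc (Suc n)) + 2 * a n"
        by (rule mult_left_le_imp_le) simp
      then show ?thesis by (simp add: field_simps)
    qed
  qed
  then have "(\<Sum>v\<in>level (length v). (h v)\<^sup>2) = 0" by (simp add: a_def)
  then have "\<forall>w\<in>level (length v). h w = 0"
    by (simp add: sum_nonneg_eq_0_iff finite_level)
  then show ?thesis by (simp add: level_eq)
qed

text \<open>Subtracting \<open>h []\<close> reduces to a bounded harmonic function vanishing at the
  root, at the cost of doubling the bound.\<close>

lemma liouville_G:
  assumes "uniform_expanders E"
  shows "liouville \<G>"
  unfolding liouville_def
proof clarify
  fix h :: "bool list \<Rightarrow> real"
  assume harm: "harmonic \<G> h" and bdd: "bounded (h ` verts \<G>)" and "\<not> h constant_on verts \<G>"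
  from bdd obtain B where "\<bar>h v\<bar> \<le> B" for v
    by (auto simp: bounded_iff verts_G)
  then have "\<bar>h v - h []\<bar> \<le> B + B" for v
    by (meson abs_triangle_ineq4 add_mono order_trans)
  then have "h v - h [] = 0" for v
    by (rule bounded_harmonic_eq_0[OF assms harmonic_diff_const[OF harm]]) simp
  then have "h constant_on verts \<G>"
    unfolding constant_on_def by (intro exI[of _ "h []"]) simp
  with \<open>\<not> h constant_on verts \<G>\<close> show False by contradiction
qed

end

theorem mainTheorem1:
  fixes E :: "nat \<Rightarrow> bool list multigraph"
  assumes "\<And>n. multigraph (E n)"
    and "\<And>n. verts (E n) = level n"
    and "\<And>n. regular 3 (E n)"
    and "uniform_expanders E"
  shows "bounded_degree (add_edges binary_tree E) \<and>
         nonamenable (add_edges binary_tree E) \<and>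
         liouville (add_edges binary_tree E)"
proof -
  interpret tree_with_levels E
    by (rule tree_with_levels.intro) (fact assms)+
  show ?thesis
    using bounded_degree_G nonamenable_G liouville_G[OF assms(4)] by blast
qed

end
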